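(* Connected algorithms have approximation ratio $\Omega(\log n)$ for NANIP with convex cost functions: there exist a convex cost function $f$, a constant $c>0$, and connected graphs $G$ with arbitrarily large number $n$ of vertices such that every connected permutation $\sigma$ of the vertices of $G$ satisfies $C_G(\sigma)\ge c\log(n)\cdot \min_\tau C_G(\tau)$, where the minimum is over all permutations $\tau$.
   Context: An instance of NANIP consists of a finite undirected graph $G=(V,E)$ with $n=|V|$ vertices and a cost function $f:\mathbb{N}\to\mathbb{R}_{\ge 0}$. For a permutation $\sigma=(v_1,\dots,v_n)$ of $V$, $r(v_t,G,\sigma)$ is the number of neighbors of $v_t$ in $G$ appearing before $v_t$ in $\sigma$, and $C_G(\sigma)=\sum_{t=1}^n f(r(v_t,G,\sigma))$. The function $f$ is convex if $f(i+2)-f(i+1)\ge f(i+1)-f(i)$ for all $i$. A permutation $\sigma$ is connected if every prefix $(v_1,\dots,v_t)$ induces a connected subgraph of $G$; a connected algorithm is one that always outputs a connected permutation. *)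

theory Defs
  imports
    Complex_Main
    "HOL-Combinatorics.Multiset_Permutations"
    "Graph_Theory.Graph_Theory"
begin

text \<open>
  A finite undirected simple graph is a \<^locale>\<open>pair_graph\<close>: each undirected edge is
  represented by its two opposite arcs, so \<open>(u, v) \<in> parcs G\<close> says that \<open>u\<close> and \<open>v\<close> are
  neighbours. Permutations of the vertex set are lists, indexed from 0.
\<close>

definition prior_neighbors :: "'a pair_pre_digraph \<Rightarrow> 'a list \<Rightarrow> nat \<Rightarrow> nat" where
  "prior_neighbors G \<sigma> t = card {u \<in> set (take t \<sigma>). (u, \<sigma> ! t) \<in> parcs G}"

definition nanip_cost :: "(nat \<Rightarrow> real) \<Rightarrow> 'a pair_pre_digraph \<Rightarrow> 'a list \<Rightarrow> real" where
  "nanip_cost f G \<sigma> = (\<Sum>t<length \<sigma>. f (prior_neighbors G \<sigma> t))"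

definition nanip_opt :: "(nat \<Rightarrow> real) \<Rightarrow> 'a pair_pre_digraph \<Rightarrow> real" where
  "nanip_opt f G = Min (nanip_cost f G ` permutations_of_set (pverts G))"

definition convex_cost :: "(nat \<Rightarrow> real) \<Rightarrow> bool" where
  "convex_cost f \<longleftrightarrow> (\<forall>i. f (i + 2) - f (i + 1) \<ge> f (i + 1) - f i)"

text \<open>The empty prefix is left out, since \<^const>\<open>connected\<close> graphs are nonempty.\<close>

definition connected_permutation :: "'a pair_pre_digraph \<Rightarrow> 'a list \<Rightarrow> bool" where
  "connected_permutation G \<sigma> \<longleftrightarrow>
     \<sigma> \<in> permutations_of_set (pverts G) \<and>
     (\<forall>t\<in>{1..length \<sigma>}. Digraph_Component.connected (with_proj G \<restriction> set (take t \<sigma>)))"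

end

theory Submission
  imports Defs
begin

text \<open>
  The cost \<open>f i = max 0 (i - 2)\<close> charges a vertex of a cubic graph exactly when all its
  neighbours precede it. Take \<open>m\<close> copies of \<open>K\<^sub>4\<close> with one edge subdivided, and join the \<open>m\<close>
  subdivision vertices by pendant edges to a cycle of length \<open>m\<close>. Each block is 2-degenerate with
  its subdivision vertex last, so visiting every block before its cycle vertex costs nothing until
  the very last cycle vertex. A connected permutation instead enters every block but the
  one it starts in through its cycle vertex; then the last vertex of the block comes after all three
  of its neighbours. This gives cost at least \<open>m - 1\<close> against an optimum of 1.
\<close>

section \<open>Connected permutations of an arbitrary graph\<close>

text \<open>A connected prefix with at least two vertices has no isolated vertex: a path from its
  last vertex \<open>\<sigma> ! t\<close> to \<open>\<sigma> ! 0\<close> starts with an edge to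
  another vertex of the prefix, hence to an earlier one.\<close>

lemma connected_permutation_prior_adjacent:
  assumes "pair_graph G" "connected_permutation G \<sigma>" "0 < t" "t < length \<sigma>"
  obtains u where "u \<in> set (take t \<sigma>)" "(u, \<sigma> ! t) \<in> parcs G"
proof -
  interpret pair_graph G by fact
  let ?S = "set (take (Suc t) \<sigma>)"
  let ?H = "with_proj G \<restriction> ?S"
  have dist: "distinct \<sigma>"
    using assms(2) by (auto simp: connected_permutation_def permutations_of_set_def)
  have "Digraph_Component.connected ?H"
    using assms(2,4) by (auto simp: connected_permutation_def)
  moreover have S: "?S = insert (\<sigma> ! t) (set (take t \<sigma>))"
    using assms(4) by (simp add: take_Suc_conv_app_nth)
  moreover have "\<sigma> ! 0 \<in> set (take t \<sigma>)"
    using assms(3,4) by (auto simp: in_set_conv_nth)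
  ultimately have "(\<sigma> ! t, \<sigma> ! 0) \<in> rtrancl_on ?S ((arcs_ends ?H)\<^sup>s)"
    by (simp add: connected_conv)
  then have "(\<sigma> ! t, \<sigma> ! 0) \<in> ((arcs_ends ?H)\<^sup>s)\<^sup>*"
    by (rule rtrancl_on_rtranclI)
  moreover have "\<sigma> ! t \<noteq> \<sigma> ! 0"
    using dist assms(3,4) by (metis less_trans nth_eq_iff_index_eq less_irrefl)
  ultimately obtain w where w: "(\<sigma> ! t, w) \<in> (arcs_ends ?H)\<^sup>s"
    by (meson converse_rtranclE)
  then have "(\<sigma> ! t, w) \<in> parcs G \<or> (w, \<sigma> ! t) \<in> parcs G" and "w \<in> ?S"
    by (auto simp: symcl_def arcs_ends_def arc_to_ends_def)
  then have "(w, \<sigma> ! t) \<in> parcs G" and "w \<noteq> \<sigma> ! t"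
    using arcs_symmetric no_loops' by blast+
  with \<open>w \<in> ?S\<close> S show thesis
    using that by blast
qed

section \<open>The graph family and its connectivity\<close>

text \<open>Block \<open>i\<close> is \<open>{6i..6i+4}\<close> with subdivision vertex \<open>6i+4\<close>, and \<open>6i+5\<close> is its cycle vertex.\<close>

definition back_edge :: "nat \<Rightarrow> nat \<Rightarrow> nat \<Rightarrow> bool" where
  "back_edge m u v \<longleftrightarrow> v < 6 * m \<and>
    (v mod 6 = 1 \<and> u + 1 = v
     \<or> v mod 6 = 2 \<and> (u + 1 = v \<or> u + 2 = v)
     \<or> v mod 6 = 3 \<and> (u + 1 = v \<or> u + 3 = v)
     \<or> v mod 6 = 4 \<and> (u + 1 = v \<or> u + 3 = v)
     \<or> v mod 6 = 5 \<and> (u + 1 = v \<or> u + 6 = v)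
     \<or> v + 1 = 6 * m \<and> u = 5)"

text \<open>For \<open>m \<ge> 3\<close> each edge of \<open>back_edge\<close> runs from the smaller
  to the larger number, so the back edges into \<open>v\<close> come exactly from its prior
  neighbours in the order \<open>[0..<6 * m]\<close>. The last disjunct of \<open>back_edge\<close>
  closes the cycle.\<close>

definition necklace :: "nat \<Rightarrow> nat pair_pre_digraph" where
  "necklace m = \<lparr>pverts = {..<6 * m}, parcs = {(u, v). back_edge m u v \<or> back_edge m v u}\<rparr>"

lemma pverts_necklace [simp]: "pverts (necklace m) = {..<6 * m}"
  by (simp add: necklace_def)

lemma parcs_necklace [simp]:
  "(u, v) \<in> parcs (necklace m) \<longleftrightarrow> back_edge m u v \<or> back_edge m v u"
  by (simp add: necklace_def)

lemma back_edge_less: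
  assumes "m \<ge> 3" "back_edge m u v"
  shows "u < v" "v < 6 * m"
  using assms unfolding back_edge_def by auto

lemma pair_graph_necklace:
  assumes "m \<ge> 3"
  shows "pair_graph (necklace m)"
proof
  show verts: "fst e \<in> pverts (necklace m)" "snd e \<in> pverts (necklace m)"
    if "e \<in> parcs (necklace m)" for e
    using that back_edge_less[OF assms] by (cases e; force)+
  show "finite (pverts (necklace m))"
    by simp
  have "parcs (necklace m) \<subseteq> {..<6 * m} \<times> {..<6 * m}"
    using verts by fastforce
  then show "finite (parcs (necklace m))"
    by (rule finite_subset) simp
  show "fst e \<noteq> snd e" if "e \<in> parcs (necklace m)" for e
    using that back_edge_less(1)[OF assms] by (cases e) force
  show "symmetric (with_proj (necklace m))"
    by (auto simp: symmetric_def sym_def)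
qed

text \<open>Vertex 5 serves as a hub. Within \<open>{6i..6i+5}\<close> consecutive numbers are
  adjacent, so every vertex climbs to its cycle vertex and then descends along the cycle to 5;
  symmetry gives the way back.\<close>

lemma connected_necklace:
  assumes "m \<ge> 3"
  shows "Digraph_Component.connected (with_proj (necklace m))"
proof -
  let ?G = "necklace m"
  interpret pair_graph ?G by (rule pair_graph_necklace[OF assms])
  have cycle: "(6 * i + 5) \<rightarrow>\<^sup>*\<^bsub>with_proj ?G\<^esub> 5" if "i < m" for i
    using that
  proof (induction i)
    case 0
    then show ?case by simp
  next
    case (Suc i)
    have "back_edge m (6 * i + 5) (6 * Suc i + 5)"
      using Suc.prems by (auto simp: back_edge_def)
    then have "(6 * Suc i + 5, 6 * i + 5) \<in> parcs ?G"
      unfolding parcs_necklace by blast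
    moreover have "(6 * i + 5) \<rightarrow>\<^sup>*\<^bsub>with_proj ?G\<^esub> 5"
      using Suc by simp
    ultimately show ?case
      by (rule adj_reachable_trans)
  qed
  have block: "v \<rightarrow>\<^sup>*\<^bsub>with_proj ?G\<^esub> 5" if "v < 6 * m" for v
    using that
  \<comment> \<open>The measure counts the steps left to the cycle vertex.\<close>
  proof (induction "5 - v mod 6" arbitrary: v rule: less_induct)
    case less
    show ?case
    proof (cases "v mod 6 = 5")
      case True
      then have "v = 6 * (v div 6) + 5"
        using mult_div_mod_eq[of 6 v] by simp
      moreover have "v div 6 < m"
        using less.prems by (simp add: less_mult_imp_div_less mult.commute)
      ultimately show ?thesis
        using cycle[of "v div 6"] by simp
    next
      case False
      moreover have "v mod 6 < 6"
        by simp
      ultimately have mod: "(v + 1) mod 6 = Suc (v mod 6)" "v mod 6 < 5"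
        by (simp_all add: mod_Suc)
      then have "v + 1 \<noteq> 6 * m"
        by (metis mod_mult_self1_is_0 nat.distinct(1))
      then have v: "v + 1 < 6 * m"
        using less.prems by simp
      have "back_edge m v (v + 1)"
        using v mod unfolding back_edge_def by (simp, linarith)
      then have "(v, v + 1) \<in> parcs ?G"
        by simp
      moreover have "(v + 1) \<rightarrow>\<^sup>*\<^bsub>with_proj ?G\<^esub> 5"
        using v mod by (intro less.hyps) auto
      ultimately show ?thesis
        by (rule adj_reachable_trans)
    qed
  qed
  have "strongly_connected (with_proj ?G)"
  proof (rule strongly_connectedI)
    show "verts (with_proj ?G) \<noteq> {}"
      using assms by (auto simp: lessThan_empty_iff)
    fix u v assume "u \<in> verts (with_proj ?G)" "v \<in> verts (with_proj ?G)"
    then have "u \<rightarrow>\<^sup>*\<^bsub>with_proj ?G\<^esub> 5" "5 \<rightarrow>\<^sup>*\<^bsub>with_proj ?G\<^esub> v"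
      using block symmetric_reachable'[of v 5] by simp_all
    then show "u \<rightarrow>\<^sup>*\<^bsub>with_proj ?G\<^esub> v"
      by (rule reachable_trans)
  qed
  then show ?thesis
    unfolding Digraph_Component.connected_def strongly_connected_def
    using reachable_mk_symmetricI by simp
qed

section \<open>The cost function and the optimum\<close>

text \<open>Truncated subtraction on \<open>nat\<close> supplies the maximum with 0.\<close>

definition excess2 :: "nat \<Rightarrow> real" where
  "excess2 i = real (i - 2)"

lemma excess2_nonneg: "excess2 i \<ge> 0"
  by (simp add: excess2_def)

lemma convex_excess2: "convex_cost excess2"
  by (auto simp: convex_cost_def excess2_def of_nat_diff)

lemma back_edge_simps:
  assumes "k < m"
  shows "back_edge m (6 * k) (6 * k + 1)" "back_edge m (6 * k) (6 * k + 2)"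
    "back_edge m (6 * k) (6 * k + 3)" "back_edge m (6 * k + 1) (6 * k + 2)"
    "back_edge m (6 * k + 1) (6 * k + 4)" "back_edge m (6 * k + 2) (6 * k + 3)"
    "back_edge m (6 * k + 3) (6 * k + 4)" "back_edge m (6 * k + 4) (6 * k + 5)"
    and "Suc k < m \<Longrightarrow> back_edge m (6 * k + 5) (6 * k + 11)"
    and "back_edge m 5 (6 * m - 1)"
proof -
  have mods: "(6 * k + c) mod 6 = c mod 6" for c
    by simp
  show "Suc k < m \<Longrightarrow> back_edge m (6 * k + 5) (6 * k + 11)"
    unfolding back_edge_def mods by simp
  show "back_edge m 5 (6 * m - 1)"
    using assms by (simp add: back_edge_def)
  show "back_edge m (6 * k) (6 * k + 1)" "back_edge m (6 * k) (6 * k + 2)"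
    "back_edge m (6 * k) (6 * k + 3)" "back_edge m (6 * k + 1) (6 * k + 2)"
    "back_edge m (6 * k + 1) (6 * k + 4)" "back_edge m (6 * k + 2) (6 * k + 3)"
    "back_edge m (6 * k + 3) (6 * k + 4)" "back_edge m (6 * k + 4) (6 * k + 5)"
    using assms unfolding back_edge_def mods by simp_all
qed

lemma necklace_neighbors_ge_3:
  assumes "m \<ge> 3" "v < 6 * m"
  obtains A where "card A = 3" "A \<subseteq> {u. (u, v) \<in> parcs (necklace m)}"
proof -
  define k where "k = v div 6"
  have "v = 6 * k + v mod 6" "v mod 6 < 6" and k: "k < m"
    using assms(2) unfolding k_def by presburger+
  then consider "v = 6 * k" | "v = 6 * k + 1" | "v = 6 * k + 2" | "v = 6 * k + 3"
    | "v = 6 * k + 4" | "v = 6 * k + 5"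
    by linarith
  then show thesis
  proof cases
    case 1
    show thesis
      by (rule that[of "{6 * k + 1, 6 * k + 2, 6 * k + 3}"]) (use k 1 back_edge_simps in auto)
  next
    case 2
    show thesis
      by (rule that[of "{6 * k, 6 * k + 2, 6 * k + 4}"]) (use k 2 back_edge_simps in auto)
  next
    case 3
    show thesis
      by (rule that[of "{6 * k, 6 * k + 1, 6 * k + 3}"]) (use k 3 back_edge_simps in auto)
  next
    case 4
    show thesis
      by (rule that[of "{6 * k, 6 * k + 2, 6 * k + 4}"]) (use k 4 back_edge_simps in auto)
  next
    case 5
    show thesis
      by (rule that[of "{6 * k + 1, 6 * k + 3, 6 * k + 5}"]) (use k 5 back_edge_simps in auto)
  next
    case 6
    \<comment> \<open>The cycle neighbours depend on the position: first vertex, last vertex, or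
      interior. The first and last are joined by the closing edge, and \<open>m \<ge> 3\<close>
      keeps the two cycle neighbours distinct.\<close>
    consider "k = 0" | j where "k = Suc j" "Suc k = m" | j where "k = Suc j" "Suc k < m"
      using k by (metis Suc_lessI not0_implies_Suc)
    then show thesis
    proof cases
      case 1
      show thesis
        by (rule that[of "{4, 11, 6 * m - 1}"])
          (use assms(1) 1 6 back_edge_simps[of 0 m] in auto)
    next
      case (2 j)
      show thesis
        by (rule that[of "{6 * k + 4, 6 * j + 5, 5}"])
          (use assms(1) 2 6 back_edge_simps[of k m] back_edge_simps(9)[of j m] in
            \<open>auto simp: algebra_simps\<close>)
    next
      case (3 j)
      show thesis
        by (rule that[of "{6 * k + 4, 6 * j + 5, 6 * k + 11}"])
          (use 3 6 back_edge_simps[of k m] back_edge_simps(9)[of j m] in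
            \<open>auto simp: algebra_simps\<close>)
    qed
  qed
qed

text \<open>Minimum degree 3 makes a vertex preceded by all its neighbours cost at least 1. This is
  the source of both lower bounds: on the optimum and on connected permutations.\<close>

lemma excess2_ge_1_if_neighbors_prior:
  assumes "m \<ge> 3" "\<sigma> ! t < 6 * m"
    and "\<And>u. (u, \<sigma> ! t) \<in> parcs (necklace m) \<Longrightarrow> u \<in> set (take t \<sigma>)"
  shows "excess2 (prior_neighbors (necklace m) \<sigma> t) \<ge> 1"
proof -
  obtain A where A: "card A = 3" "A \<subseteq> {u. (u, \<sigma> ! t) \<in> parcs (necklace m)}"
    using necklace_neighbors_ge_3[OF assms(1,2)] .
  have "card A \<le> prior_neighbors (necklace m) \<sigma> t"
    unfolding prior_neighbors_def using A(2) assms(3) by (intro card_mono) auto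
  then have "3 \<le> prior_neighbors (necklace m) \<sigma> t"
    using A(1) by simp
  then show ?thesis
    by (simp add: excess2_def)
qed

text \<open>In any order the last vertex is preceded by all its neighbours.\<close>

lemma nanip_cost_necklace_ge_1:
  assumes "m \<ge> 3" "\<sigma> \<in> permutations_of_set (pverts (necklace m))"
  shows "nanip_cost excess2 (necklace m) \<sigma> \<ge> 1"
proof -
  have \<sigma>: "set \<sigma> = {..<6 * m}" "distinct \<sigma>"
    using assms(2) by (auto simp: permutations_of_set_def)
  then have len: "length \<sigma> = 6 * m"
    using distinct_card by fastforce
  define t where "t = 6 * m - 1"
  have t: "t < length \<sigma>" "Suc t = length \<sigma>"
    using len assms(1) by (simp_all add: t_def)
  then have \<sigma>t: "\<sigma> ! t < 6 * m"
    using \<sigma>(1) nth_mem by blast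
  have "\<sigma> = take t \<sigma> @ [\<sigma> ! t]"
    using take_Suc_conv_app_nth[OF t(1)] t(2) by simp
  then have "set \<sigma> = set (take t \<sigma> @ [\<sigma> ! t])"
    by (rule arg_cong)
  then have "set \<sigma> = insert (\<sigma> ! t) (set (take t \<sigma>))"
    by simp
  moreover interpret pair_graph "necklace m" by (rule pair_graph_necklace[OF assms(1)])
  have "u \<in> set \<sigma>" "u \<noteq> \<sigma> ! t" if "(u, \<sigma> ! t) \<in> parcs (necklace m)" for u
    using in_arcsD1[OF that] no_loops'[OF that] \<sigma>(1) by auto
  ultimately have "1 \<le> excess2 (prior_neighbors (necklace m) \<sigma> t)"
    by (intro excess2_ge_1_if_neighbors_prior assms \<sigma>t) blast
  also have "\<dots> \<le> nanip_cost excess2 (necklace m) \<sigma>"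
    unfolding nanip_cost_def using t by (intro member_le_sum) (auto simp: excess2_nonneg)
  finally show ?thesis .
qed

lemma prior_neighbors_upt_le:
  assumes "m \<ge> 3" "t < 6 * m"
  shows "prior_neighbors (necklace m) [0..<6 * m] t \<le> (if t = 6 * m - 1 then 3 else 2)"
proof -
  have prior: "prior_neighbors (necklace m) [0..<6 * m] t = card {u. back_edge m u t}"
    unfolding prior_neighbors_def
    using assms back_edge_less[OF assms(1)] by (intro arg_cong[of _ _ card]) force
  \<comment> \<open>\<open>w\<close> is the smaller neighbour other than \<open>t - 1\<close>, where
    there is one. For \<open>t = 5\<close> and for residues 0 and 1 it is a dummy value, which is
    harmless because only an inclusion is claimed.\<close>
  define w where "w = (if t mod 6 = 2 then t - 2 else if t mod 6 = 5 then t - 6 else t - 3)"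
  have sub: "{u. back_edge m u t} \<subseteq> set ([t - 1, w] @ (if t = 6 * m - 1 then [5] else []))"
    using assms by (auto simp: back_edge_def w_def)
  have "card {u. back_edge m u t} \<le> length ([t - 1, w] @ (if t = 6 * m - 1 then [5] else []))"
    using card_mono[OF _ sub] card_length order_trans by blast
  then show ?thesis
    by (simp add: prior split: if_splits)
qed

text \<open>The order \<open>[0..<6 * m]\<close> attains the lower bound 1: only its last vertex,
  where the cycle closes, has three smaller neighbours.\<close>

lemma nanip_opt_necklace:
  assumes "m \<ge> 3"
  shows "nanip_opt excess2 (necklace m) = 1"
proof (rule antisym)
  let ?C = "nanip_cost excess2 (necklace m)"
  let ?P = "permutations_of_set (pverts (necklace m))"
  have fin: "finite (?C ` ?P)"
    by simp
  have mem: "[0..<6 * m] \<in> ?P"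
    by (auto simp: permutations_of_set_def)
  have "?C [0..<6 * m] \<le> (\<Sum>t<6 * m. if t = 6 * m - 1 then 1 else 0)"
    unfolding nanip_cost_def length_upt diff_zero
  proof (rule sum_mono)
    fix t assume "t \<in> {..<6 * m}"
    then show "excess2 (prior_neighbors (necklace m) [0..<6 * m] t)
        \<le> (if t = 6 * m - 1 then 1 else 0)"
      using prior_neighbors_upt_le[OF assms, of t] by (auto simp: excess2_def split: if_splits)
  qed
  also have "\<dots> = 1"
    using assms by simp
  finally show "nanip_opt excess2 (necklace m) \<le> 1"
    unfolding nanip_opt_def using mem fin by (meson Min_le imageI order_trans)
  show "nanip_opt excess2 (necklace m) \<ge> 1"
    unfolding nanip_opt_def using mem fin nanip_cost_necklace_ge_1[OF assms]
    by (subst Min_ge_iff) auto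
qed

section \<open>Lower bound for connected permutations\<close>

text \<open>The cycle vertex \<open>6 * i + 5\<close> is the only gate of block \<open>i\<close>,
  because every edge between different groups of six joins two cycle vertices.\<close>

lemma block_adjacent:
  assumes "m \<ge> 3" "i < m" "v div 6 = i" "v mod 6 \<noteq> 5" "(u, v) \<in> parcs (necklace m)"
  shows "u div 6 = i \<and> u mod 6 \<noteq> 5 \<or> u = 6 * i + 5"
proof -
  define r where "r = v mod 6"
  have v: "v = 6 * i + r" "r < 5"
    using assms(3,4) unfolding r_def by presburger+
  have "6 * i \<le> u \<and> u \<le> 6 * i + 5"
    using assms(5) unfolding parcs_necklace
  proof
    assume "back_edge m u v"
    then show ?thesis
      using v assms(2) unfolding back_edge_def r_def[symmetric] by linarith
  next
    assume u: "back_edge m v u"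
    \<comment> \<open>Cycle edges are ruled out since \<open>v\<close> is no cycle vertex. Any other
      back edge into \<open>u\<close> has length at most \<open>u mod 6\<close>, so it does not
      cross a multiple of 6.\<close>
    have "u \<noteq> v + 6" if "u mod 6 = 5"
      using that v(2) r_def by auto
    moreover have "v \<noteq> 5"
      using v(2) r_def by auto
    ultimately obtain d where d: "u = v + d" "d \<le> u mod 6"
      using u unfolding back_edge_def by (elim conjE disjE) fastforce+
    have u_eq: "u = 6 * (u div 6) + u mod 6" "u mod 6 < 6"
      by simp_all
    then have "v div 6 = u div 6"
      using d by (intro div_nat_eqI; (simp only: mult_Suc_right)?; linarith)
    then show ?thesis
      using u_eq assms(3) by linarith
  qed
  then have "u = 6 * i + 5 \<or> u div 6 = i \<and> u < 6 * i + 5"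
    by (auto intro: div_nat_eqI)
  then show ?thesis
    using div_mult_mod_eq[of u 6] by linarith
qed

text \<open>The first visited vertex of the block must be entered through the gate, so the gate
  precedes the last visited one, whose other neighbours lie in the block and are earlier too. The
  hypothesis on \<open>\<sigma> ! 0\<close> excludes starting at the gate as well as inside the
  block.\<close>

lemma connected_permutation_necklace_block_cost:
  assumes "m \<ge> 3" "connected_permutation (necklace m) \<sigma>" "i < m" "i \<noteq> \<sigma> ! 0 div 6"
  obtains t where "t < 6 * m" "\<sigma> ! t div 6 = i"
    "excess2 (prior_neighbors (necklace m) \<sigma> t) \<ge> 1"
proof -
  interpret pair_graph "necklace m" by (rule pair_graph_necklace[OF assms(1)])
  have \<sigma>: "set \<sigma> = {..<6 * m}" "distinct \<sigma>"
    using assms(2) by (auto simp: connected_permutation_def permutations_of_set_def)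
  then have len: "length \<sigma> = 6 * m"
    using distinct_card by fastforce
  \<comment> \<open>\<open>T\<close> collects positions in \<open>\<sigma>\<close>, not vertices;
    \<open>a\<close> and \<open>b\<close> below are the first and last visits to the block.\<close>
  define T where "T = {t. t < 6 * m \<and> \<sigma> ! t div 6 = i \<and> \<sigma> ! t mod 6 \<noteq> 5}"
  have fin: "finite T"
    by (simp add: T_def)
  have "6 * i \<in> set \<sigma>"
    using \<sigma>(1) assms(3) by simp
  then obtain k where "k < 6 * m" "\<sigma> ! k = 6 * i"
    by (metis in_set_conv_nth len)
  then have "k \<in> T"
    by (simp add: T_def)
  then have ne: "T \<noteq> {}"
    by blast
  define a where "a = Min T"
  define b where "b = Max T"
  have a: "a \<in> T" and b: "b \<in> T" and "a \<le> b"
    using fin ne by (auto simp: a_def b_def)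
  have "a > 0"
    using a assms(4) by (intro gr0I) (auto simp: T_def)
  moreover have "a < length \<sigma>"
    using a len by (simp add: T_def)
  ultimately obtain u where u: "u \<in> set (take a \<sigma>)" "(u, \<sigma> ! a) \<in> parcs (necklace m)"
    using connected_permutation_prior_adjacent[OF pair_graph_necklace[OF assms(1)] assms(2)]
    by blast
  then obtain k where k: "k < a" "\<sigma> ! k = u"
    using \<open>a < length \<sigma>\<close> by (auto simp: in_set_conv_nth)
  \<comment> \<open>By minimality of \<open>a\<close> the earlier neighbour \<open>u\<close> lies
    outside the block, so it can only be the gate.\<close>
  have "k \<notin> T"
    using k(1) fin Min_le unfolding a_def by fastforce
  then have "u = 6 * i + 5"
    using block_adjacent[OF assms(1,3) _ _ u(2)] a k by (auto simp: T_def)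
  then have cyc: "6 * i + 5 \<in> set (take b \<sigma>)"
    using u(1) set_take_subset_set_take[OF \<open>a \<le> b\<close>] by (metis subsetD)
  have prior: "v \<in> set (take b \<sigma>)" if v: "(v, \<sigma> ! b) \<in> parcs (necklace m)" for v
  proof (cases "v = 6 * i + 5")
    case True
    then show ?thesis using cyc by simp
  next
    case False
    obtain j where j: "j < 6 * m" "\<sigma> ! j = v"
      using in_arcsD1[OF v] \<sigma>(1) len by (metis in_set_conv_nth pverts_necklace)
    have "j \<in> T"
      using block_adjacent[OF assms(1,3) _ _ v] b j False by (auto simp: T_def)
    then have "j \<le> b"
      using fin by (simp add: b_def)
    moreover have "j \<noteq> b"
      using no_loops'[OF v] j(2) by auto
    ultimately show ?thesis
      using j len by (auto simp: in_set_conv_nth intro!: exI[of _ j])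
  qed
  have "\<sigma> ! b < 6 * m"
    using b \<sigma>(1) len nth_mem by (fastforce simp: T_def)
  then show thesis
    using b prior by (intro that[of b] excess2_ge_1_if_neighbors_prior assms(1)) (auto simp: T_def)
qed

text \<open>The charged positions of different blocks differ, since the vertex there determines the
  block. Hence the charges of all blocks but the starting one add up.\<close>

lemma connected_permutation_necklace_cost:
  assumes "m \<ge> 3" "connected_permutation (necklace m) \<sigma>"
  shows "nanip_cost excess2 (necklace m) \<sigma> \<ge> real m - 1"
proof -
  let ?I = "{..<m} - {\<sigma> ! 0 div 6}"
  let ?e = "\<lambda>t. excess2 (prior_neighbors (necklace m) \<sigma> t)"
  have len: "length \<sigma> = 6 * m"
    using assms(2) distinct_card
    by (fastforce simp: connected_permutation_def permutations_of_set_def)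
  have "\<forall>i\<in>?I. \<exists>t. t < 6 * m \<and> \<sigma> ! t div 6 = i \<and> ?e t \<ge> 1"
    using connected_permutation_necklace_block_cost[OF assms] by (metis DiffE insertI1 lessThan_iff)
  then obtain g where g: "\<And>i. i \<in> ?I \<Longrightarrow> g i < 6 * m \<and> \<sigma> ! g i div 6 = i \<and> ?e (g i) \<ge> 1"
    by metis
  have inj: "inj_on g ?I"
    using g by (metis inj_onI)
  have "real m - 1 \<le> real (card ?I)"
    using diff_card_le_card_Diff[of "{\<sigma> ! 0 div 6}" "{..<m}"] by simp
  also have "\<dots> = (\<Sum>i\<in>?I. 1)"
    by simp
  also have "\<dots> \<le> (\<Sum>i\<in>?I. ?e (g i))"
    using g by (intro sum_mono) blast
  also have "\<dots> = sum ?e (g ` ?I)"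
    using inj by (simp add: sum.reindex)
  also have "\<dots> \<le> nanip_cost excess2 (necklace m) \<sigma>"
    unfolding nanip_cost_def using g len by (intro sum_mono2) (auto simp: excess2_nonneg)
  finally show ?thesis .
qed

text \<open>The conjunct \<open>nanip_opt f G > 0\<close> keeps the ratio bound from holding
  trivially.\<close>

theorem theorem3:
  shows "\<exists>(f :: nat \<Rightarrow> real) (c :: real).
    (\<forall>i. f i \<ge> 0) \<and> convex_cost f \<and> c > 0 \<and>
    (\<forall>N. \<exists>G :: nat pair_pre_digraph.
       pair_graph G \<and> Digraph_Component.connected (with_proj G) \<and> card (pverts G) \<ge> N \<and>
       nanip_opt f G > 0 \<and>
       (\<forall>\<sigma>. connected_permutation G \<sigma> \<longrightarrow>
          nanip_cost f G \<sigma> \<ge> c * ln (real (card (pverts G))) * nanip_opt f G))"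
proof (intro exI[of _ excess2] exI[of _ "1 / 12 :: real"] conjI allI)
  fix N :: nat
  \<comment> \<open>This gives both \<open>m \<ge> 3\<close> and
    \<open>6 * m \<ge> N\<close>.\<close>
  define m where "m = N + 3"
  have m: "m \<ge> 3"
    by (simp add: m_def)
  have "1 / 12 * ln (real (card (pverts (necklace m)))) * nanip_opt excess2 (necklace m)
      \<le> nanip_cost excess2 (necklace m) \<sigma>" if "connected_permutation (necklace m) \<sigma>" for \<sigma>
  proof -
    \<comment> \<open>The lower bound \<open>m - 1\<close> is linear in the number
      \<open>6 * m\<close> of vertices, so the crude \<open>ln x \<le> x\<close> suffices: with the
      factor 1/12 it leaves \<open>m / 2\<close>, which is at most \<open>m - 1\<close>.\<close>
    have "ln (real (6 * m)) \<le> real (6 * m)"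
      using m by (intro less_imp_le ln_less_self) simp
    then have "1 / 12 * ln (real (6 * m)) \<le> real m - 1"
      using m by simp
    then show ?thesis
      using connected_permutation_necklace_cost[OF m that] by (simp add: nanip_opt_necklace[OF m])
  qed
  then show "\<exists>G :: nat pair_pre_digraph.
       pair_graph G \<and> Digraph_Component.connected (with_proj G) \<and> card (pverts G) \<ge> N \<and>
       nanip_opt excess2 G > 0 \<and>
       (\<forall>\<sigma>. connected_permutation G \<sigma> \<longrightarrow>
          nanip_cost excess2 G \<sigma> \<ge> 1 / 12 * ln (real (card (pverts G))) * nanip_opt excess2 G)"
    using m by (intro exI[of _ "necklace m"])
      (auto simp: pair_graph_necklace connected_necklace nanip_opt_necklace m_def)
qed (auto simp: excess2_nonneg convex_excess2)

end
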